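(* Let $q$ be a prime power, $\alpha$ a primitive element of $\mathbb{F}_{q^4}$, and $C=\{j(q+1)\mid j\in\{0,1,\dots,q^2\}\}$. Let $v$ be a positive divisor of $q-1$ such that $q\ge v^3+4v$. Then the array $\mathcal{A}_{q^4/q}(\alpha,C;v)$ is a covering array $\mathrm{CA}(v(q^3+q^2+q+1);\,4,\,q^2+1,\,v)$.
   Context: A primitive element of a finite field is a generator of its multiplicative group. Let $\mathrm{Tr}(x)=x+x^q+x^{q^2}+x^{q^3}$ be the trace from $\mathbb{F}_{q^4}$ to $\mathbb{F}_q$. The element $\omega=\alpha^{q^3+q^2+q+1}$ is a primitive element of $\mathbb{F}_q$; for $x\in\mathbb{F}_q^\times$, $\log_\omega(x)$ is the unique $j\in\{0,\dots,q-2\}$ with $\omega^j=x$. For $C=\{c_0<\dots<c_{k-1}\}\subseteq\{0,\dots,q^4-2\}$, $\mathcal{A}_{q^4/q}(\alpha,C;v)$ is the $v(q^3+q^2+q+1)\times k$ array with entries in $\{0,\dots,v-1\}$ whose $(i,j)$ entry, for $0\le i\le v(q^3+q^2+q+1)-1$ and $0\le j\le k-1$, is $\log_\omega(\mathrm{Tr}(\alpha^{i+c_j}))\bmod v$ if $\mathrm{Tr}(\alpha^{i+c_j})\neq0$, and $0$ otherwise. A covering array $\mathrm{CA}(N;t,k,v)$ ($t\le k$) is an $N\times k$ array over an alphabet $V$ of size $v$ such that for every $t$ distinct columns, each element of $V^t$ occurs at least once as a row of the subarray formed by these columns. *)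

theory Defs
  imports "HOL-Number_Theory.Prime_Powers" "Jordan_Normal_Form.Matrix"
begin

definition primitive_element :: "'a::field \<Rightarrow> bool" where
  "primitive_element \<alpha> \<longleftrightarrow> range (\<lambda>n::int. \<alpha> powi n) = UNIV - {0}"

(* The trace from the field with q^4 elements down to its subfield with q elements; its values
   are kept in the large field, where that subfield is {x. x ^ q = x}. *)
definition field_trace :: "nat \<Rightarrow> 'a::field \<Rightarrow> 'a" where
  "field_trace q x = x + x ^ q + x ^ (q ^ 2) + x ^ (q ^ 3)"

(* Meaningful when \<omega> generates the nonzero elements of the subfield with q elements and x is one
   of them. *)
definition discrete_log :: "nat \<Rightarrow> 'a::field \<Rightarrow> 'a \<Rightarrow> nat" where
  "discrete_log q \<omega> x = (THE j. j \<in> {0..q - 2} \<and> \<omega> ^ j = x)"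

(* C = {c_0 < ... < c_(k-1)} is a finite set, and c_j is sorted_list_of_set C ! j. *)
definition trace_array :: "nat \<Rightarrow> 'a::field \<Rightarrow> nat set \<Rightarrow> nat \<Rightarrow> nat mat" where
  "trace_array q \<alpha> C v =
     (let \<omega> = \<alpha> ^ (q ^ 3 + q ^ 2 + q + 1) in
      mat (v * (q ^ 3 + q ^ 2 + q + 1)) (card C) (\<lambda>(i, j).
        let x = field_trace q (\<alpha> ^ (i + sorted_list_of_set C ! j)) in
        if x \<noteq> 0 then discrete_log q \<omega> x mod v else 0))"

(* cs lists t distinct column indices and xs is an element of V^t. *)
definition covering_array :: "'b set \<Rightarrow> nat \<Rightarrow> nat \<Rightarrow> nat \<Rightarrow> nat \<Rightarrow> 'b mat \<Rightarrow> bool" where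
  "covering_array V N t k v A \<longleftrightarrow>
     t \<le> k \<and> finite V \<and> card V = v \<and> A \<in> carrier_mat N k \<and> elements_mat A \<subseteq> V \<and>
     (\<forall>cs xs. length cs = t \<and> distinct cs \<and> set cs \<subseteq> {..<k} \<and> length xs = t \<and> set xs \<subseteq> V \<longrightarrow>
        (\<exists>i<N. map (\<lambda>c. A $$ (i, c)) cs = xs))"

end

theory Submission
  imports Defs "HOL-Number_Theory.Residues" "HOL-Computational_Algebra.Polynomial"
begin

text \<open>Multiplying \<open>x = \<alpha> ^ i\<close> by \<open>\<omega> ^ v\<close> does not change the logarithms modulo \<open>v\<close>, so the
  rows are indexed by all nonzero \<open>x\<close>, and \<open>x\<close> gives the traces \<open>Tr (x * y)\<close> at the points
  \<open>y = \<alpha> ^ (j * (q + 1))\<close> of an elliptic quadric. If four of these points are independent over the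
  subfield, their traces take arbitrary values, because the trace form is nondegenerate. Otherwise, as
  no three of them are collinear, they satisfy exactly one linear relation and all its coefficients are
  nonzero. The traces then take all values that satisfy this relation, and it remains to solve
  \<open>a + b + c + d = 0\<close> with \<open>a, b, c, d\<close> in prescribed cosets of the group \<open>H\<close> of \<open>v\<close>-th powers.
  A second moment count of incidences between the points of a product of two cosets and the
  lines \<open>m * x + y = s\<close> shows that this is possible if \<open>card H ^ 3 > q ^ 2\<close>, and this follows from
  \<open>q \<ge> v ^ 3 + 4 * v\<close>.\<close>

section \<open>Incidences between the points of a product set and lines\<close>

text \<open>The count is real because its deviation from the mean is squared below.\<close>

definition incidences :: "'a::field set \<Rightarrow> 'a set \<Rightarrow> 'a \<Rightarrow> 'a \<Rightarrow> real" where
  "incidences A B m s = real (card {p \<in> A \<times> B. m * fst p + snd p = s})"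

lemma incidences_sum:
  assumes "finite A" "finite B"
  shows "incidences A B m s = (\<Sum>p\<in>A\<times>B. of_bool (m * fst p + snd p = s))"
  using assms by (simp add: incidences_def Int_def)

text \<open>Two distinct points lie on a common line for at most one slope, so only the diagonal
  pairs \<open>p = p'\<close> contribute to the bound beyond the squared mean.\<close>

lemma incidence_variance:
  fixes K A B :: "'a::field set"
  assumes K: "finite K" "K \<noteq> {}" "\<And>x y. x \<in> K \<Longrightarrow> y \<in> K \<Longrightarrow> x + y \<in> K"
    "\<And>x y. x \<in> K \<Longrightarrow> y \<in> K \<Longrightarrow> x * y \<in> K"
    and AB: "A \<subseteq> K" "B \<subseteq> K"
  shows "(\<Sum>m\<in>K. \<Sum>s\<in>K. (incidences A B m s - real (card A * card B) / card K)\<^sup>2)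
          \<le> real (card K) * real (card A * card B)"
proof -
  define P where "P = A \<times> B"
  define l where "l = (\<lambda>m (p::'a\<times>'a). m * fst p + snd p)"
  define q where "q = real (card K)"
  define n where "n = real (card A * card B)"
  define I where "I = incidences A B"
  have fin: "finite A" "finite B" using AB K(1) finite_subset by auto
  have finP: "finite P" using fin by (simp add: P_def)
  have cardP: "real (card P) = n" by (simp add: P_def n_def card_cartesian_product)
  have q: "q > 0" using K by (simp add: q_def card_gt_0_iff)
  have lK: "l m p \<in> K" if "m \<in> K" "p \<in> P" for m p
    using that K AB unfolding l_def P_def by (metis mem_Times_iff subsetD)
  have I: "I m s = (\<Sum>p\<in>P. of_bool (l m p = s))" for m s
    using incidences_sum[OF fin] by (simp add: I_def P_def l_def)
  have row: "(\<Sum>s\<in>K. I m s) = n" if "m \<in> K" for m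
  proof -
    have "(\<Sum>s\<in>K. I m s) = (\<Sum>p\<in>P. \<Sum>s\<in>K. of_bool (l m p = s))"
      unfolding I by (rule sum.swap)
    also have "\<dots> = (\<Sum>p\<in>P. 1)"
      using lK[OF that] K(1) by (intro sum.cong refl) (simp add: of_bool_def)
    finally show ?thesis by (simp add: cardP)
  qed
  have collide: "(\<Sum>m\<in>K. of_bool (l m p = l m p')) \<le> (1::real) + (if p' = p then q else 0)" 
    if "p \<in> P" "p' \<in> P" for p p'
  proof (cases "p' = p")
    case False
    have "(\<Sum>m\<in>K. of_bool (l m p = l m p')) = real (card {m\<in>K. l m p = l m p'})"
      using K(1) by (simp add: of_bool_def sum.If_cases Int_def)
    also have "card {m\<in>K. l m p = l m p'} \<le> 1"
    proof -
      have "m = m'" if "l m p = l m p'" "l m' p = l m' p'" for m m'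
      proof (rule ccontr)
        assume "m \<noteq> m'"
        have "(m - m') * (fst p - fst p') = 0"
        proof -
          have "(m - m') * (fst p - fst p') = (l m p - l m p') - (l m' p - l m' p')"
            by (simp add: l_def algebra_simps)
          then show ?thesis using that by simp
        qed
        then have "fst p = fst p'" using \<open>m \<noteq> m'\<close> by simp
        with that have "snd p = snd p'" by (simp add: l_def)
        with \<open>fst p = fst p'\<close> False show False by (simp add: prod_eq_iff)
      qed
      then show ?thesis using K(1) by (subst card_le_Suc0_iff_eq[unfolded One_nat_def[symmetric]]) auto
    qed
    finally show ?thesis using False by simp
  qed (simp add: q_def)
  \<comment> \<open>The second moment counts a slope together with an ordered pair of points on the
    same line of that slope.\<close>
  have "(\<Sum>m\<in>K. \<Sum>s\<in>K. (I m s)\<^sup>2)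
      = (\<Sum>m\<in>K. \<Sum>s\<in>K. \<Sum>p\<in>P. \<Sum>p'\<in>P. of_bool (l m p = s) * of_bool (l m p' = s))"
    by (simp add: I power2_eq_square sum_product)
  also have "\<dots> = (\<Sum>m\<in>K. \<Sum>p\<in>P. \<Sum>p'\<in>P. \<Sum>s\<in>K. of_bool (l m p = s) * of_bool (l m p' = s))"
    by (intro sum.cong refl, subst sum.swap, intro sum.cong refl, rule sum.swap)
  also have "\<dots> = (\<Sum>m\<in>K. \<Sum>p\<in>P. \<Sum>p'\<in>P. of_bool (l m p = l m p'))"
  proof (intro sum.cong refl)
    fix m p p' assume "m \<in> K" "p \<in> P" "p' \<in> P"
    have "(\<Sum>s\<in>K. of_bool (l m p = s) * of_bool (l m p' = s))
       = (\<Sum>s\<in>K. if l m p = s then of_bool (l m p = l m p') else (0::real))"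
      by (intro sum.cong refl) auto
    then show "(\<Sum>s\<in>K. of_bool (l m p = s) * of_bool (l m p' = s)) = (of_bool (l m p = l m p') :: real)"
      using lK \<open>m \<in> K\<close> \<open>p \<in> P\<close> K(1) by simp
  qed
  also have "\<dots> = (\<Sum>p\<in>P. \<Sum>p'\<in>P. \<Sum>m\<in>K. of_bool (l m p = l m p'))"
    by (subst sum.swap, intro sum.cong refl, rule sum.swap)
  also have "\<dots> \<le> (\<Sum>p\<in>P. \<Sum>p'\<in>P. 1 + (if p' = p then q else 0))"
    by (intro sum_mono collide)
  also have "\<dots> = n * n + n * q"
    using finP by (simp add: sum.distrib cardP distrib_left)
  finally have sq: "(\<Sum>m\<in>K. \<Sum>s\<in>K. (I m s)\<^sup>2) \<le> n * n + n * q" .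
  \<comment> \<open>The cross term \<open>- 2 * n * n\<close> and the constant term
    \<open>n * n\<close> together cancel the \<open>n * n\<close> in \<open>sq\<close>.\<close>
  have "(\<Sum>m\<in>K. \<Sum>s\<in>K. (I m s - n / q)\<^sup>2)
      = (\<Sum>m\<in>K. \<Sum>s\<in>K. (I m s)\<^sup>2) - 2 * (n / q) * (\<Sum>m\<in>K. \<Sum>s\<in>K. I m s) + (\<Sum>m\<in>K. \<Sum>s\<in>K. (n / q)\<^sup>2)"
    by (simp add: power2_diff sum.distrib sum_subtractf sum_distrib_left sum_divide_distrib mult_ac)
  also have "(\<Sum>m\<in>K. \<Sum>s\<in>K. I m s) = q * n" by (simp add: row q_def)
  also have "(\<Sum>m\<in>K. \<Sum>s\<in>K. (n / q)\<^sup>2) = n * n"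
    using q by (simp add: power2_eq_square flip: q_def)
  also have "2 * (n / q) * (q * n) = 2 * n * n" using q by simp
  finally have "(\<Sum>m\<in>K. \<Sum>s\<in>K. (I m s - n / q)\<^sup>2) \<le> q * n"
    using sq by (simp add: mult.commute)
  then show ?thesis unfolding I_def q_def n_def .
qed

text \<open>A subset closed under multiplication by \<open>H\<close> meets the lines of every slope in \<open>H\<close> in the
  same way, so the average over all slopes controls the sums \<open>x + y\<close>, which belong to slope 1.\<close>

lemma coset_sum_variance:
  fixes K A B H :: "'a::field set"
  assumes K: "finite K" "K \<noteq> {}" "\<And>x y. x \<in> K \<Longrightarrow> y \<in> K \<Longrightarrow> x + y \<in> K"
    "\<And>x y. x \<in> K \<Longrightarrow> y \<in> K \<Longrightarrow> x * y \<in> K"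
    and AB: "A \<subseteq> K" "B \<subseteq> K" and H: "H \<subseteq> K - {0}"
    and inv: "\<And>h x. h \<in> H \<Longrightarrow> x \<in> A \<Longrightarrow> h * x \<in> A"
  shows "real (card H) * (\<Sum>s\<in>K. (incidences A B 1 s - real (card A * card B) / card K)\<^sup>2)
          \<le> real (card K) * real (card A * card B)"
proof -
  have fin: "finite A" "finite B" using AB K(1) finite_subset by auto
  have eq: "incidences A B h s = incidences A B 1 s" if h: "h \<in> H" for h s
  proof -
    have h0: "h \<noteq> 0" using h H by auto
    \<comment> \<open>An injective map of the finite set \<open>A\<close> into itself is
      onto.\<close>
    have img: "(\<lambda>x. h * x) ` A = A"
      by (rule card_subset_eq) (use fin inv[OF h] h0 in \<open>auto simp: card_image inj_on_def\<close>)
    \<comment> \<open>Scaling the first coordinate by \<open>h\<close> turns slope \<open>h\<close>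
      into slope 1 and keeps \<open>s\<close>.\<close>
    have "bij_betw (\<lambda>p. (h * fst p, snd p)) {p \<in> A \<times> B. h * fst p + snd p = s} {p \<in> A \<times> B. 1 * fst p + snd p = s}"
      unfolding bij_betw_def
    proof (intro conjI subset_antisym subsetI)
      show "inj_on (\<lambda>p. (h * fst p, snd p)) {p \<in> A \<times> B. h * fst p + snd p = s}"
        using h0 by (auto simp: inj_on_def)
      show "y \<in> {p \<in> A \<times> B. 1 * fst p + snd p = s}"
        if "y \<in> (\<lambda>p. (h * fst p, snd p)) ` {p \<in> A \<times> B. h * fst p + snd p = s}" for y
        using that inv[OF h] by auto
      fix y assume y: "y \<in> {p \<in> A \<times> B. 1 * fst p + snd p = s}"
      then obtain x where "x \<in> A" "fst y = h * x" using img by (auto simp: image_iff) blast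
      with y show "y \<in> (\<lambda>p. (h * fst p, snd p)) ` {p \<in> A \<times> B. h * fst p + snd p = s}"
        by (intro image_eqI[of _ _ "(x, snd y)"]) auto
    qed
    then show ?thesis by (simp add: incidences_def bij_betw_same_card)
  qed
  let ?d = "real (card A * card B) / card K"
  have "real (card H) * (\<Sum>s\<in>K. (incidences A B 1 s - ?d)\<^sup>2) = (\<Sum>m\<in>H. \<Sum>s\<in>K. (incidences A B m s - ?d)\<^sup>2)"
    by (simp add: eq)
  also have "\<dots> \<le> (\<Sum>m\<in>K. \<Sum>s\<in>K. (incidences A B m s - ?d)\<^sup>2)"
    using H K(1) by (intro sum_mono2 sum_nonneg) auto
  also have "\<dots> \<le> real (card K) * real (card A * card B)"
    by (rule incidence_variance) fact+
  finally show ?thesis .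
qed

text \<open>If the sumsets were disjoint, the representation counts \<open>f\<close> and
  \<open>g\<close> would have disjoint supports, and their deviations from the common mean would be
  so negatively correlated that the two variance bounds fail.\<close>

lemma cosets_sumsets_meet:
  fixes K H A B C D :: "'a::field set"
  assumes K: "finite K" "K \<noteq> {}" "\<And>x y. x \<in> K \<Longrightarrow> y \<in> K \<Longrightarrow> x + y \<in> K"
    "\<And>x y. x \<in> K \<Longrightarrow> y \<in> K \<Longrightarrow> x * y \<in> K"
    and sub: "A \<subseteq> K" "B \<subseteq> K" "C \<subseteq> K" "D \<subseteq> K" and H: "H \<subseteq> K - {0}"
    and inv: "\<And>h x. h \<in> H \<Longrightarrow> x \<in> A \<Longrightarrow> h * x \<in> A" "\<And>h x. h \<in> H \<Longrightarrow> x \<in> C \<Longrightarrow> h * x \<in> C"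
    and card: "card A = card H" "card B = card H" "card C = card H" "card D = card H"
    and large: "card H ^ 3 > card K ^ 2"
  shows "\<exists>a\<in>A. \<exists>b\<in>B. \<exists>c\<in>C. \<exists>d\<in>D. a + b = c + d"
proof (rule ccontr)
  assume "\<not> ?thesis"
  then have disj: "a + b \<noteq> c + d" if "a \<in> A" "b \<in> B" "c \<in> C" "d \<in> D" for a b c d
    using that by blast
  define n where "n = real (card H)"
  define q where "q = real (card K)"
  define f where "f = incidences A B 1"
  define g where "g = incidences C D 1"
  define \<mu> where "\<mu> = n * n / q"
  have q: "q > 0" using K by (simp add: q_def card_gt_0_iff)
  have big: "n ^ 3 > q ^ 2" using large unfolding n_def q_def by (metis of_nat_less_iff of_nat_power)
  have n: "n > 0" using big q unfolding n_def by (cases "card H = 0") auto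
  have fin: "finite A" "finite B" "finite C" "finite D" using sub[THEN finite_subset] K(1) by auto
  have total: "(\<Sum>s\<in>K. incidences X Y 1 s) = real (card X * card Y)"
    if "X \<subseteq> K" "Y \<subseteq> K" "finite X" "finite Y" for X Y
  proof -
    have "(\<Sum>s\<in>K. incidences X Y 1 s) = (\<Sum>p\<in>X\<times>Y. \<Sum>s\<in>K. of_bool (1 * fst p + snd p = s))"
      unfolding incidences_sum[OF that(3,4)] by (rule sum.swap)
    also have "\<dots> = (\<Sum>p\<in>X\<times>Y. 1)"
    proof (intro sum.cong refl)
      fix p assume "p \<in> X \<times> Y"
      then have "fst p \<in> K" "snd p \<in> K" using that by auto
      then have "fst p + snd p \<in> K" by (rule K(3))
      then show "(\<Sum>s\<in>K. of_bool (1 * fst p + snd p = s)) = (1::real)"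
        using K(1) by (simp add: of_bool_def)
    qed
    finally show ?thesis by (simp add: card_cartesian_product)
  qed
  have sf: "(\<Sum>s\<in>K. f s) = n * n" and sg: "(\<Sum>s\<in>K. g s) = n * n"
    using total[of A B] total[of C D] sub fin card by (simp_all add: f_def g_def n_def)
  have fg: "f s * g s = 0" for s
  proof (rule ccontr)
    assume "f s * g s \<noteq> 0"
    then have "{p \<in> A \<times> B. 1 * fst p + snd p = s} \<noteq> {}" "{p \<in> C \<times> D. 1 * fst p + snd p = s} \<noteq> {}"
      by (auto simp: f_def g_def incidences_def simp del: Collect_empty_eq)
    then show False using disj by fastforce
  qed
  have vf: "n * (\<Sum>s\<in>K. (f s - \<mu>)\<^sup>2) \<le> q * (n * n)"
    using coset_sum_variance[OF K sub(1,2) H inv(1)] card by (simp add: f_def \<mu>_def n_def q_def)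
  have vg: "n * (\<Sum>s\<in>K. (g s - \<mu>)\<^sup>2) \<le> q * (n * n)"
    using coset_sum_variance[OF K sub(3,4) H inv(2)] card by (simp add: g_def \<mu>_def n_def q_def)
  \<comment> \<open>Each summand is the square of
    \<open>(f s - \<mu>) + (g s - \<mu>)\<close>.\<close>
  have "(\<Sum>s\<in>K. (f s - \<mu>)\<^sup>2 + (g s - \<mu>)\<^sup>2 + 2 * ((f s - \<mu>) * (g s - \<mu>))) \<ge> 0"
  proof (intro sum_nonneg)
    fix s
    have "(f s - \<mu>)\<^sup>2 + (g s - \<mu>)\<^sup>2 + 2 * ((f s - \<mu>) * (g s - \<mu>)) = ((f s - \<mu>) + (g s - \<mu>))\<^sup>2"
      by (simp add: power2_eq_square algebra_simps)
    then show "0 \<le> (f s - \<mu>)\<^sup>2 + (g s - \<mu>)\<^sup>2 + 2 * ((f s - \<mu>) * (g s - \<mu>))" by simp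
  qed
  \<comment> \<open>Disjoint supports remove the product \<open>f s * g s\<close>, and
    \<open>q * \<mu> = n * n\<close> collapses the rest to one negative term.\<close>
  moreover have "(\<Sum>s\<in>K. (f s - \<mu>) * (g s - \<mu>)) = - \<mu> * (n * n)"
  proof -
    have "(f s - \<mu>) * (g s - \<mu>) = \<mu> * \<mu> - \<mu> * f s - \<mu> * g s" for s
      using fg[of s] by (simp add: algebra_simps)
    then have "(\<Sum>s\<in>K. (f s - \<mu>) * (g s - \<mu>)) = q * (\<mu> * \<mu>) - \<mu> * (n * n) - \<mu> * (n * n)"
      by (simp add: sum_subtractf sf sg q_def flip: sum_distrib_left)
    also have "q * (\<mu> * \<mu>) = \<mu> * (n * n)" using q by (simp add: \<mu>_def)
    finally show ?thesis by simp
  qed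
  ultimately have "2 * (\<mu> * (n * n)) \<le> (\<Sum>s\<in>K. (f s - \<mu>)\<^sup>2) + (\<Sum>s\<in>K. (g s - \<mu>)\<^sup>2)"
    by (simp add: sum.distrib flip: sum_distrib_left)
  moreover have "x \<le> q * n" if "n * x \<le> q * (n * n)" for x
  proof -
    have "n * x \<le> n * (q * n)" using that by (simp add: mult_ac)
    then show ?thesis using n by simp
  qed
  note this[OF vf] this[OF vg]
  ultimately have "\<mu> * (n * n) \<le> q * n" by simp
  \<comment> \<open>As \<open>\<mu> = n * n / q\<close>, this amounts to
    \<open>n ^ 3 \<le> q ^ 2\<close>, against \<open>big\<close>.\<close>
  then have "q * (\<mu> * (n * n)) \<le> q * (q * n)" using q by simp
  also have "q * (\<mu> * (n * n)) = n ^ 3 * n" using q by (simp add: \<mu>_def power3_eq_cube)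
  also have "q * (q * n) = q ^ 2 * n" by (simp add: power2_eq_square)
  finally have "n ^ 3 * n \<le> q ^ 2 * n" .
  with n big show False by simp
qed

section \<open>The field with \<open>q ^ 4\<close> elements and its subfield with \<open>q\<close>
  elements\<close>

text \<open>Multiplication by \<open>x\<close> permutes the nonzero elements and so does not change
  their product.\<close>

lemma finite_field_power_card_minus_1:
  fixes x :: "'a::{field,finite}"
  assumes "x \<noteq> 0"
  shows "x ^ (card (UNIV :: 'a set) - 1) = 1"
proof -
  have "(\<Prod>y\<in>UNIV-{0}. x * y) = (\<Prod>y\<in>UNIV-{0}. y)"
    by (rule prod.reindex_bij_witness[of _ "\<lambda>y. y / x" "\<lambda>y. x * y"]) (use assms in auto)
  then have "x ^ (card (UNIV :: 'a set) - 1) * \<Prod>(UNIV - {0}) = \<Prod>(UNIV - {0})"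
    by (simp add: prod.distrib)
  then show ?thesis by simp
qed

locale quartic_extension =
  fixes q :: nat and \<alpha> :: "'a::{field,finite}"
  assumes primepow: "primepow q"
    and card_UNIV: "card (UNIV :: 'a set) = q ^ 4"
    and primitive: "primitive_element \<alpha>"
begin

definition K :: "'a set" where "K = {x. x ^ q = x}"

text \<open>The index of the group of nonzero elements of \<open>K\<close> in the whole
  multiplicative group.\<close>

definition M :: nat where "M = q ^ 3 + q ^ 2 + q + 1"

definition \<omega> :: 'a where "\<omega> = \<alpha> ^ M"

lemma q_gt_1: "q > 1"
  using primepow_gt_Suc_0[OF primepow] by simp

lemma q4_pos: "q ^ 4 - 1 > 0"
  using one_less_power[OF q_gt_1, of 4] by simp

lemma M_pos: "M > 0"
  by (simp add: M_def)

lemma M_factor: "q ^ 4 - 1 = (q - 1) * M"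
proof -
  have "int (q ^ 4 - 1) = int ((q - 1) * M)"
    using q_gt_1 by (simp add: M_def of_nat_diff algebra_simps power4_eq_xxxx power3_eq_cube power2_eq_square)
  then show ?thesis by linarith
qed

text \<open>The characteristic divides \<open>q ^ 4\<close>, so it is the prime below
  \<open>q\<close>, and the map is an iterate of the Frobenius map.\<close>

lemma frobenius_add: "(x + y) ^ (q ^ n) = x ^ (q ^ n) + y ^ (q ^ n)" for x y :: 'a
proof -
  obtain p k where p: "prime p" "q = p ^ k" "k > 0"
    using primepow by (auto simp: primepow_def)
  have C: "prime CHAR('a)"
    using prime_CHAR_semidom[where ?'a = 'a] finite_imp_CHAR_pos[where ?'a = 'a] by simp
  have "CHAR('a) dvd p ^ (k * 4)"
    using CHAR_dvd_CARD[where ?'a = 'a] card_UNIV by (simp add: p(2) power_mult)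
  then have "CHAR('a) = p"
    using C p(1) prime_dvd_power primes_dvd_imp_eq by blast
  then show ?thesis
    by (intro freshmans_dream'[OF C, of _ "k * n"]) (simp add: p(2) power_mult)
qed

lemma frobenius_diff: "(x - y) ^ (q ^ n) = x ^ (q ^ n) - y ^ (q ^ n)" for x y :: 'a
  using frobenius_add[of "x - y" y n] by simp

lemma power_q4: "x ^ (q ^ 4) = x" for x :: 'a
proof (cases "x = 0")
  case False
  have "x ^ (q ^ 4) = x ^ (q ^ 4 - 1) * x"
    using power_minus_mult[of "q ^ 4" x] q_gt_1 by simp
  then show ?thesis using finite_field_power_card_minus_1[OF False] card_UNIV by simp
qed (use q_gt_1 in auto)

lemma \<alpha>_nonzero: "\<alpha> \<noteq> 0"
proof
  assume "\<alpha> = 0"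
  have "\<alpha> powi 0 \<in> UNIV - {0}" by simp
  moreover have "\<alpha> powi 1 \<in> range (\<lambda>n::int. \<alpha> powi n)" by blast
  ultimately show False using primitive \<open>\<alpha> = 0\<close> by (simp add: primitive_element_def)
qed

lemma \<alpha>_power_order: "\<alpha> ^ (q ^ 4 - 1) = 1"
  using finite_field_power_card_minus_1[OF \<alpha>_nonzero] card_UNIV by simp

lemma \<alpha>_power_mod: "\<alpha> ^ (n mod (q ^ 4 - 1)) = \<alpha> ^ n"
proof -
  have "\<alpha> ^ n = \<alpha> ^ ((q ^ 4 - 1) * (n div (q ^ 4 - 1)) + n mod (q ^ 4 - 1))" by simp
  also have "\<dots> = \<alpha> ^ (n mod (q ^ 4 - 1))"
    by (simp only: power_add power_mult \<alpha>_power_order power_one mult_1)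
  finally show ?thesis by simp
qed

lemma \<alpha>_generates:
  assumes "x \<noteq> 0"
  obtains n where "n < q ^ 4 - 1" "x = \<alpha> ^ n"
proof -
  define N where "N = q ^ 4 - 1"
  have N: "N > 0" using q4_pos by (simp only: N_def)
  from assms primitive obtain k :: int where k: "x = \<alpha> powi k"
    unfolding primitive_element_def by blast
  have N1: "\<alpha> powi int N = 1" by (simp only: N_def power_int_of_nat \<alpha>_power_order)
  \<comment> \<open>Reduction modulo the order turns the integer exponent from
    \<open>primitive_element\<close> into a natural one.\<close>
  have "\<alpha> powi k = \<alpha> powi (int N * (k div int N) + k mod int N)" by simp
  also have "\<dots> = \<alpha> powi (k mod int N)"
    using \<alpha>_nonzero N1 by (simp only: power_int_add power_int_mult power_int_1_left mult_1 simp_thms)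
  also have "\<dots> = \<alpha> ^ nat (k mod int N)"
    using N by (simp add: power_int_def)
  finally have "x = \<alpha> ^ nat (k mod int N)" using k by simp
  moreover have "nat (k mod int N) < N" using N by (simp add: nat_less_iff)
  ultimately show thesis using that N_def by blast
qed

text \<open>The powers exhaust the \<open>q ^ 4 - 1\<close> nonzero elements, so none is
  repeated.\<close>

lemma \<alpha>_power_inj: "inj_on (\<lambda>n. \<alpha> ^ n) {..<q ^ 4 - 1}"
proof (rule eq_card_imp_inj_on)
  have "(\<lambda>n. \<alpha> ^ n) ` {..<q ^ 4 - 1} = UNIV - {0}"
  proof (intro subset_antisym subsetI)
    fix x :: 'a assume "x \<in> UNIV - {0}"
    then obtain n where "n < q ^ 4 - 1" "x = \<alpha> ^ n" using \<alpha>_generates by blast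
    then show "x \<in> (\<lambda>n. \<alpha> ^ n) ` {..<q ^ 4 - 1}" by blast
  qed (use \<alpha>_nonzero in auto)
  then show "card ((\<lambda>n. \<alpha> ^ n) ` {..<q ^ 4 - 1}) = card {..<q ^ 4 - 1}"
    using card_UNIV by simp
qed simp

lemma \<alpha>_power_eq_iff: "\<alpha> ^ m = \<alpha> ^ n \<longleftrightarrow> m mod (q ^ 4 - 1) = n mod (q ^ 4 - 1)"
proof -
  have "\<alpha> ^ (m mod (q ^ 4 - 1)) = \<alpha> ^ (n mod (q ^ 4 - 1)) \<longleftrightarrow> m mod (q ^ 4 - 1) = n mod (q ^ 4 - 1)"
    using q4_pos by (intro inj_on_eq_iff[OF \<alpha>_power_inj]) auto
  then show ?thesis by (simp only: \<alpha>_power_mod)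
qed

lemma \<omega>_power_eq_iff: "\<omega> ^ m = \<omega> ^ n \<longleftrightarrow> m mod (q - 1) = n mod (q - 1)"
proof -
  have "\<omega> ^ m = \<omega> ^ n \<longleftrightarrow> (M * m) mod (M * (q - 1)) = (M * n) mod (M * (q - 1))"
    by (simp only: \<omega>_def flip: power_mult) (simp only: \<alpha>_power_eq_iff M_factor mult.commute)
  also have "\<dots> \<longleftrightarrow> m mod (q - 1) = n mod (q - 1)"
    using M_pos by (simp add: mult_mod_right[symmetric])
  finally show ?thesis .
qed

lemma \<omega>_nonzero: "\<omega> \<noteq> 0"
  by (simp add: \<omega>_def \<alpha>_nonzero)

lemma K_0: "0 \<in> K" and K_1: "1 \<in> K"
  using q_gt_1 by (auto simp: K_def)

lemma K_add: "x \<in> K \<Longrightarrow> y \<in> K \<Longrightarrow> x + y \<in> K"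
  using frobenius_add[of x y 1] by (simp add: K_def)

lemma K_diff: "x \<in> K \<Longrightarrow> y \<in> K \<Longrightarrow> x - y \<in> K"
  using frobenius_diff[of x y 1] by (simp add: K_def)

lemma K_uminus: "x \<in> K \<Longrightarrow> - x \<in> K"
  using K_diff[OF K_0] by simp

lemma K_mult: "x \<in> K \<Longrightarrow> y \<in> K \<Longrightarrow> x * y \<in> K"
  by (simp add: K_def power_mult_distrib)

lemma K_divide: "x \<in> K \<Longrightarrow> y \<in> K \<Longrightarrow> x / y \<in> K"
  by (simp add: K_def power_divide)

lemma K_nonzero_iff: "x \<in> K \<and> x \<noteq> 0 \<longleftrightarrow> x ^ (q - 1) = 1"
proof -
  have "x ^ q = x ^ (q - 1) * x" using power_minus_mult[of q x] q_gt_1 by simp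
  moreover have "x ^ (q - 1) = 1 \<Longrightarrow> x \<noteq> 0" using q_gt_1 by (auto simp: power_0_left)
  ultimately show ?thesis by (auto simp: K_def)
qed

lemma \<omega>_in_K: "\<omega> ^ n \<in> K"
proof -
  have "\<omega> ^ (q - 1) = 1"
    using \<omega>_power_eq_iff[of "q - 1" 0] by simp
  then have "(\<omega> ^ n) ^ (q - 1) = 1" by (metis mult.commute power_mult power_one)
  then show ?thesis using K_nonzero_iff by blast
qed

text \<open>The nonzero elements of \<open>K\<close> satisfy \<open>x ^ (q - 1) = 1\<close>; for
  \<open>x = \<alpha> ^ n\<close> this forces \<open>M\<close> to divide \<open>n\<close>.\<close>

lemma K_eq_powers: "K - {0} = (\<lambda>n. \<omega> ^ n) ` {..<q - 1}"
proof (intro subset_antisym subsetI)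
  fix x assume x: "x \<in> K - {0}"
  then obtain n where n: "x = \<alpha> ^ n" using \<alpha>_generates by blast
  have "x ^ (q - 1) = 1" using x K_nonzero_iff by blast
  then have "\<alpha> ^ (n * (q - 1)) = \<alpha> ^ 0" by (simp add: n power_mult)
  then have "(q - 1) * M dvd n * (q - 1)"
    unfolding \<alpha>_power_eq_iff M_factor by (simp add: dvd_eq_mod_eq_0)
  then have "M dvd n" using q_gt_1 by (simp add: mult.commute)
  then obtain k where "n = M * k" by blast
  then have "x = \<omega> ^ k" by (simp add: n \<omega>_def power_mult)
  also have "\<dots> = \<omega> ^ (k mod (q - 1))" by (simp add: \<omega>_power_eq_iff)
  finally show "x \<in> (\<lambda>n. \<omega> ^ n) ` {..<q - 1}" using q_gt_1 by auto
qed (auto simp: \<omega>_in_K \<omega>_nonzero)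

lemma card_K: "card K = q"
proof -
  have "inj_on (\<lambda>n. \<omega> ^ n) {..<q - 1}"
    by (auto simp: inj_on_def \<omega>_power_eq_iff)
  then have "card (K - {0}) = q - 1" by (simp add: K_eq_powers card_image)
  then show ?thesis using K_0 q_gt_1 by (simp add: card_Diff_singleton_if)
qed

text \<open>Exponents of \<open>\<omega>\<close> matter modulo \<open>q - 1\<close>, and
  \<open>v\<close> divides \<open>q - 1\<close>, so the residue modulo \<open>v\<close> can be read
  off any exponent.\<close>

lemma discrete_log_mod:
  assumes "v dvd q - 1"
  shows "discrete_log q \<omega> (\<omega> ^ n) mod v = n mod v"
proof -
  have "discrete_log q \<omega> (\<omega> ^ n) = n mod (q - 1)"
    unfolding discrete_log_def
  proof (rule the_equality)
    have "n mod (q - 1) < q - 1" using q_gt_1 by simp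
    then show "n mod (q - 1) \<in> {0..q - 2} \<and> \<omega> ^ (n mod (q - 1)) = \<omega> ^ n"
      by (simp add: \<omega>_power_eq_iff)
    fix j assume "j \<in> {0..q - 2} \<and> \<omega> ^ j = \<omega> ^ n"
    then show "j = n mod (q - 1)" using q_gt_1 by (auto simp: \<omega>_power_eq_iff)
  qed
  then show ?thesis using assms by (simp add: mod_mod_cancel)
qed

section \<open>The trace and its nondegenerate bilinear form\<close>

abbreviation Tr :: "'a \<Rightarrow> 'a" where "Tr \<equiv> field_trace q"

lemma Tr_add: "Tr (x + y) = Tr x + Tr y"
  using frobenius_add[of x y 1] frobenius_add[of x y 2] frobenius_add[of x y 3]
  by (simp add: field_trace_def)

lemma Tr_scale: "c \<in> K \<Longrightarrow> Tr (c * x) = c * Tr x"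
proof -
  assume "c \<in> K"
  then have c: "c ^ q = c" by (simp add: K_def)
  then have "c ^ (q ^ 2) = c" by (simp add: power2_eq_square power_mult)
  moreover from this c have "c ^ (q ^ 3) = c" by (simp add: power3_eq_cube power2_eq_square power_mult)
  ultimately show ?thesis using c by (simp add: field_trace_def power_mult_distrib algebra_simps)
qed

lemma Tr_0: "Tr 0 = 0"
  using Tr_scale[OF K_0, of 0] by simp

lemma Tr_diff: "Tr (x - y) = Tr x - Tr y"
  using Tr_add[of "x - y" y] by simp

lemma Tr_sum: "Tr (sum f I) = (\<Sum>i\<in>I. Tr (f i))"
  by (induction I rule: infinite_finite_induct) (auto simp: Tr_0 Tr_add)

text \<open>The \<open>q\<close>-th power map permutes the four summands cyclically.\<close>

lemma Tr_in_K: "Tr x \<in> K"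
proof -
  have "(Tr x) ^ q = x ^ q + (x ^ q) ^ q + (x ^ (q ^ 2)) ^ q + (x ^ (q ^ 3)) ^ q"
    using frobenius_add[where n = 1] by (simp add: field_trace_def)
  also have "\<dots> = Tr x"
    using power_q4[of x]
    by (simp add: field_trace_def power4_eq_xxxx power3_eq_cube power2_eq_square mult.assoc flip: power_mult)
  finally show ?thesis by (simp add: K_def)
qed

text \<open>Otherwise a nonzero polynomial of degree at most \<open>q ^ 3\<close> would have
  \<open>q ^ 4\<close> roots.\<close>

lemma Tr_nontrivial: "\<exists>x. Tr x \<noteq> 0"
proof (rule ccontr)
  assume "\<nexists>x. Tr x \<noteq> 0"
  then have zero: "Tr x = 0" for x by simp
  define p where "p = Polynomial.monom (1::'a) 1 + Polynomial.monom 1 q + Polynomial.monom 1 (q ^ 2) + Polynomial.monom 1 (q ^ 3)"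
  have "poly p x = 0" for x
    using zero[of x] by (simp add: p_def poly_monom field_trace_def)
  moreover have "Polynomial.coeff p 1 = 1"
    using q_gt_1 by (simp add: p_def)
  then have "p \<noteq> 0" by auto
  ultimately have "q ^ 4 \<le> degree p"
    using card_poly_roots_bound[of p] card_UNIV by simp
  also have "degree p \<le> q ^ 3"
    unfolding p_def
    by (intro degree_add_le order_trans[OF Polynomial.degree_monom_le])
      (use q_gt_1 in \<open>auto simp: self_le_power intro: power_increasing\<close>)
  finally show False using q_gt_1 by simp
qed

lemma Tr_nondegenerate:
  assumes "\<And>x. Tr (x * y) = 0"
  shows "y = 0"
proof (rule ccontr)
  assume "y \<noteq> 0"
  then have "Tr x = 0" for x using assms[of "x / y"] by simp
  then show False using Tr_nontrivial by blast
qed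

text \<open>Linear independence over \<open>K\<close>, for families because traces are prescribed
  index by index.\<close>

definition independent :: "'i set \<Rightarrow> ('i \<Rightarrow> 'a) \<Rightarrow> bool" where
  "independent I y \<longleftrightarrow>
    (\<forall>c. (\<forall>i\<in>I. c i \<in> K) \<and> (\<Sum>i\<in>I. c i * y i) = 0 \<longrightarrow> (\<forall>i\<in>I. c i = 0))"

text \<open>By duality, a new vector \<open>y j\<close> outside the span of the others is detected
  by some \<open>w\<close> orthogonal to them; adding a multiple of \<open>w\<close> corrects the
  trace at \<open>j\<close> and keeps the others.\<close>

lemma Tr_surjective:
  assumes "finite I" "independent I y" "\<forall>i\<in>I. t i \<in> K"
  shows "\<exists>x. \<forall>i\<in>I. Tr (x * y i) = t i"
  using assms
proof (induction I arbitrary: t rule: finite_induct)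
  case (insert j I)
  have ind: "independent I y"
    unfolding independent_def
  proof (intro allI impI)
    fix c assume c: "(\<forall>i\<in>I. c i \<in> K) \<and> (\<Sum>i\<in>I. c i * y i) = 0"
    have "(\<Sum>i\<in>insert j I. (c(j := 0)) i * y i) = (\<Sum>i\<in>I. c i * y i)"
      using insert.hyps by (auto intro!: sum.cong)
    then have "\<forall>i\<in>insert j I. (c(j := 0)) i = 0"
      using insert.prems(1)[unfolded independent_def, rule_format, of "c(j := 0)"] c K_0 insert.hyps
      by (auto simp: fun_upd_def split: if_splits)
    then show "\<forall>i\<in>I. c i = 0" using insert.hyps by (metis fun_upd_other insertCI)
  qed
  \<comment> \<open>The induction hypothesis for unit vectors gives a dual family
    \<open>u\<close>.\<close>
  have "\<exists>u. \<forall>i\<in>I. Tr (u * y i) = of_bool (i = k)" for k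
    using insert.IH[OF ind, of "\<lambda>i. of_bool (i = k)"] K_0 K_1 by auto
  then obtain u where u: "\<And>k i. i \<in> I \<Longrightarrow> Tr (u k * y i) = of_bool (i = k)" by metis
  have "\<exists>w. (\<forall>i\<in>I. Tr (w * y i) = 0) \<and> Tr (w * y j) \<noteq> 0"
  proof (rule ccontr)
    assume *: "\<not> ?thesis"
    define c where "c = (\<lambda>i. Tr (u i * y j))"
    have "Tr (z * (y j - (\<Sum>i\<in>I. c i * y i))) = 0" for z
    proof -
      \<comment> \<open>Without its components along the dual family, \<open>z'\<close> is
        orthogonal to all \<open>y i\<close> with \<open>i\<close> in \<open>I\<close>, hence by
        \<open>*\<close> also to \<open>y j\<close>.\<close>
      define z' where "z' = z - (\<Sum>k\<in>I. Tr (z * y k) * u k)"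
      have proj: "Tr (z' * w) = Tr (z * w) - (\<Sum>k\<in>I. Tr (z * y k) * Tr (u k * w))" for w
        by (simp add: z'_def left_diff_distrib Tr_diff sum_distrib_right Tr_sum mult.assoc Tr_scale Tr_in_K)
      have "Tr (z' * y i) = 0" if "i \<in> I" for i
        using that insert.hyps(1) by (simp add: proj u)
      with * have "Tr (z' * y j) = 0" by blast
      then have "Tr (z * y j) = (\<Sum>k\<in>I. Tr (z * y k) * c k)" by (simp add: proj c_def)
      also have "\<dots> = Tr (z * (\<Sum>i\<in>I. c i * y i))"
      proof -
        have "Tr (z * (c i * y i)) = Tr (z * y i) * c i" for i
          using Tr_scale[OF Tr_in_K, of "u i * y j" "z * y i"] by (simp add: c_def mult_ac)
        then show ?thesis by (simp add: sum_distrib_left Tr_sum)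
      qed
      finally show ?thesis by (simp add: right_diff_distrib Tr_diff)
    qed
    then have rel: "y j - (\<Sum>i\<in>I. c i * y i) = 0" by (rule Tr_nondegenerate)
    define d where "d = (\<lambda>i. if i = j then 1 else - c i)"
    have "(\<Sum>i\<in>insert j I. d i * y i) = y j + (\<Sum>i\<in>I. - c i * y i)"
      using insert.hyps by (auto simp: d_def intro!: sum.cong)
    also have "\<dots> = 0" using rel by (simp add: sum_negf)
    finally have "(\<Sum>i\<in>insert j I. d i * y i) = 0" .
    moreover have "\<forall>i\<in>insert j I. d i \<in> K"
      using K_1 K_uminus Tr_in_K by (simp add: d_def c_def)
    ultimately have "d j = 0"
      using insert.prems(1) unfolding independent_def by blast
    then show False by (simp add: d_def)
  qed
  then obtain w where w: "\<And>i. i \<in> I \<Longrightarrow> Tr (w * y i) = 0" "Tr (w * y j) \<noteq> 0" by blast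
  obtain x where x: "\<forall>i\<in>I. Tr (x * y i) = t i"
    using insert.IH[OF ind, of t] insert.prems(2) by auto
  define c where "c = (t j - Tr (x * y j)) / Tr (w * y j)"
  have c: "c \<in> K"
    using insert.prems(2) Tr_in_K by (simp add: c_def K_divide K_diff)
  have "Tr ((x + c * w) * y i) = Tr (x * y i) + c * Tr (w * y i)" for i
    by (simp add: distrib_right Tr_add mult.assoc Tr_scale c)
  then show ?case
    using x w by (intro exI[of _ "x + c * w"]) (auto simp: c_def)
qed simp

section \<open>Points of an elliptic quadric\<close>

text \<open>The exponent is the shift that belongs to column \<open>c\<close> of the array.\<close>

definition point :: "nat \<Rightarrow> 'a" where "point c = \<alpha> ^ (c * (q + 1))"

lemma point_nonzero: "point c \<noteq> 0"
  by (simp add: point_def \<alpha>_nonzero)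

lemma q4_factor: "q ^ 4 - 1 = (q ^ 2 + 1) * ((q + 1) * (q - 1))"
proof -
  have "int (q ^ 4 - 1) = int ((q ^ 2 + 1) * ((q + 1) * (q - 1)))"
    using q_gt_1 by (simp add: of_nat_diff algebra_simps power4_eq_xxxx power2_eq_square)
  then show ?thesis by linarith
qed

text \<open>The power \<open>q - 1\<close> sends nonzero elements of \<open>K\<close> to 1, while
  \<open>\<alpha> ^ ((q + 1) * (q - 1))\<close> has order \<open>q ^ 2 + 1\<close>, which exceeds
  all indices.\<close>

lemma point_ratio_not_in_K:
  assumes "i \<le> q ^ 2" "j \<le> q ^ 2" "i \<noteq> j"
  shows "point i / point j \<notin> K"
proof
  assume "point i / point j \<in> K"
  then have "(point i / point j) ^ (q - 1) = 1"
    using K_nonzero_iff point_nonzero by (metis divide_eq_0_iff)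
  then have "point i ^ (q - 1) = point j ^ (q - 1)"
    using point_nonzero by (simp add: power_divide)
  then have "\<alpha> ^ (i * ((q + 1) * (q - 1))) = \<alpha> ^ (j * ((q + 1) * (q - 1)))"
    by (simp only: point_def mult.assoc flip: power_mult)
  then have "i mod (q ^ 2 + 1) = j mod (q ^ 2 + 1)"
    using q_gt_1 unfolding \<alpha>_power_eq_iff q4_factor by (simp only: mod_mult_mult2) simp
  then show False using assms by simp
qed

lemma points_pair:
  assumes "i \<le> q ^ 2" "j \<le> q ^ 2" "i \<noteq> j" "a \<in> K" "b \<in> K" "a * point i + b * point j = 0"
  shows "a = 0"
proof (rule ccontr)
  assume "a \<noteq> 0"
  then have "point i = (0 - b) / a * point j"
    using assms(6) by (simp add: field_simps eq_neg_iff_add_eq_0)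
  then have "point i / point j = (0 - b) / a"
    using point_nonzero by simp
  then show False
    using point_ratio_not_in_K[OF assms(1-3)] K_divide[OF K_diff[OF K_0]] assms(4,5) by metis
qed

lemma point_norm: "point i ^ (q ^ 2 + 1) \<in> K"
proof -
  have "(point i ^ (q ^ 2 + 1)) ^ (q - 1) = (\<alpha> ^ (q ^ 4 - 1)) ^ i"
    unfolding point_def q4_factor by (simp only: mult_ac flip: power_mult)
  then show ?thesis using K_nonzero_iff \<alpha>_power_order by (metis power_one)
qed

text \<open>The points lie on the elliptic quadric where the norm to the quadratic subfield takes values
  in \<open>K\<close>. If three were collinear, the ratio \<open>u\<close> of two of them would have trace and norm
  over the quadratic subfield in \<open>K\<close>; as \<open>u ^ q\<close> is a root of the resulting quadratic equation,
  \<open>u\<close> would itself be in \<open>K\<close>.\<close>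

lemma points_triple:
  assumes le: "i \<le> q ^ 2" "j \<le> q ^ 2" "k \<le> q ^ 2" and ne: "i \<noteq> j" "i \<noteq> k" "j \<noteq> k"
    and K: "a \<in> K" "b \<in> K" "c \<in> K" and rel: "a * point i + b * point j + c * point k = 0"
  shows "a = 0"
proof (rule ccontr)
  assume a: "a \<noteq> 0"
  \<comment> \<open>A vanishing coefficient would leave a relation between two points.\<close>
  have b: "b \<noteq> 0" using points_pair[OF le(1,3) ne(2) K(1,3)] rel a by auto
  have c: "c \<noteq> 0" using points_pair[OF le(1,2) ne(1) K(1,2)] rel a by auto
  define u where "u = point j / point k"
  define w where "w = point i / point k"
  define T where "T = u ^ (q ^ 2) + u"
  define N where "N = u ^ (q ^ 2 + 1)"
  have fix2: "x ^ (q ^ 2) = x" if "x \<in> K" for x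
    using that by (simp add: K_def power2_eq_square power_mult)
  have NK: "N \<in> K" and wK: "w ^ (q ^ 2 + 1) \<in> K"
    unfolding N_def u_def w_def power_divide by (intro K_divide point_norm)+
  have "a * w + b * u + c = 0"
  proof -
    have "a * w + b * u + c = (a * point i + b * point j + c * point k) / point k"
      using point_nonzero by (simp add: u_def w_def add_divide_distrib)
    then show ?thesis by (simp add: rel)
  qed
  define b' where "b' = 0 - b / a"
  define c' where "c' = 0 - c / a"
  have w: "w = b' * u + c'"
    using \<open>a * w + b * u + c = 0\<close> a by (simp add: b'_def c'_def field_simps eq_neg_iff_add_eq_0)
  have bc: "b' \<in> K" "c' \<in> K" "b' \<noteq> 0" "c' \<noteq> 0"
    using a b c K K_0 by (auto simp: b'_def c'_def intro!: K_divide K_uminus)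
  \<comment> \<open>In this expansion of the norm of \<open>w\<close>, only \<open>T\<close> is not
    yet known to lie in \<open>K\<close>.\<close>
  have "w ^ (q ^ 2 + 1) = (b' * u ^ (q ^ 2) + c') * (b' * u + c')"
    using frobenius_add[of "b' * u" c' 2] fix2 bc
    by (simp add: w power_mult_distrib mult.commute)
  also have "\<dots> = b' * b' * N + b' * c' * T + c' * c'"
    by (simp add: N_def T_def algebra_simps)
  finally have "T = (w ^ (q ^ 2 + 1) - b' * b' * N - c' * c') / (b' * c')"
    using bc by simp
  then have TK: "T \<in> K" using wK NK bc by (simp add: K_divide K_diff K_mult)
  have "T ^ q = (u ^ (q ^ 2)) ^ q + u ^ q"
    using frobenius_add[of "u ^ (q ^ 2)" u 1] by (simp add: T_def)
  then have "T - u ^ q = (u ^ (q ^ 2)) ^ q"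
    using TK by (simp add: K_def eq_diff_eq[symmetric])
  moreover have "N ^ q = (u ^ (q ^ 2)) ^ q * u ^ q"
    by (simp add: N_def power_mult_distrib)
  ultimately have "u ^ q * (T - u ^ q) = N"
    using NK by (simp add: K_def mult.commute)
  \<comment> \<open>The quadratic equation with sum of roots \<open>T\<close> and product
    \<open>N\<close> has the roots \<open>u\<close> and \<open>u ^ (q ^ 2)\<close>.\<close>
  then have "(u ^ q - u) * (u ^ q - u ^ (q ^ 2)) = 0"
    by (simp add: T_def N_def algebra_simps)
  \<comment> \<open>If \<open>u ^ q\<close> is the other root, injectivity of the Frobenius map
    still gives \<open>u ^ q = u\<close>.\<close>
  moreover have "u ^ q = u" if "u ^ q = u ^ (q ^ 2)"
  proof -
    have "(u ^ q) ^ q = u ^ (q ^ 2)"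
      by (simp only: power2_eq_square power_mult)
    then have "(u - u ^ q) ^ q = 0"
      using frobenius_diff[of u "u ^ q" 1] that by simp
    then show ?thesis by simp
  qed
  ultimately have "u \<in> K" by (auto simp: K_def)
  then show False using point_ratio_not_in_K[OF le(2,3) ne(3)] by (simp add: u_def)
qed

lemma points_independent:
  assumes "S \<subseteq> {..q ^ 2}" "card S = 3"
  shows "independent S point"
  unfolding independent_def
proof (intro allI impI ballI)
  fix c i assume c: "(\<forall>i\<in>S. c i \<in> K) \<and> (\<Sum>i\<in>S. c i * point i) = 0" and i: "i \<in> S"
  have "finite S" using assms(1) finite_subset by blast
  then have "card (S - {i}) = 2" using assms(2) i by simp
  then obtain j k where jk: "S - {i} = {j, k}" "j \<noteq> k" by (auto simp: card_2_iff)
  then have S: "S = {i, j, k}" "i \<noteq> j" "i \<noteq> k" using i by auto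
  have "c i * point i + c j * point j + c k * point k = 0"
    using c S jk(2) by (simp add: add.assoc)
  then show "c i = 0"
    by (rule points_triple[rotated -1]) (use assms(1) S c jk(2) in auto)
qed

section \<open>Diagonal equations in \<open>v\<close>-th powers\<close>

text \<open>Multiplied by \<open>v ^ 3\<close>, the claim is
  \<open>q ^ 2 * v ^ 3 < (q - 1) ^ 3\<close>. Here \<open>v ^ 3 \<le> q - 4\<close> because
  \<open>v \<ge> 1\<close>, and \<open>(q - 1) ^ 3 - q ^ 2 * (q - 4) = q ^ 2 + 3 * q - 1\<close> is
  positive.\<close>

lemma cubic_size:
  assumes "v > 0" "n * v = q - 1" "q \<ge> v ^ 3 + 4 * v"
  shows "n ^ 3 > q ^ 2"
proof -
  have "int v ^ 3 + 4 * int v \<le> int q"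
    using assms(3) by (metis of_nat_add of_nat_le_iff of_nat_mult of_nat_numeral of_nat_power)
  then have "int q ^ 2 * int v ^ 3 \<le> int q ^ 2 * (int q - 4)"
    using assms(1) by (intro mult_left_mono) auto
  also have "\<dots> < (int q - 1) ^ 3"
  proof -
    have "int q * int q > 1" using q_gt_1 by (simp add: less_1_mult)
    then have "int q * int q + int q * 3 > 1" by linarith
    then show ?thesis by (simp add: power2_eq_square power3_eq_cube algebra_simps)
  qed
  also have "int q - 1 = int n * int v"
    using assms(2) q_gt_1 by (metis less_imp_le of_nat_1 of_nat_diff of_nat_mult)
  finally have "int q ^ 2 * int v ^ 3 < int n ^ 3 * int v ^ 3" by (simp add: power_mult_distrib)
  then have "int q ^ 2 < int n ^ 3" using assms(1) by simp
  then show ?thesis by (metis of_nat_less_iff of_nat_power)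
qed

lemma diagonal_equation_solvable:
  assumes v: "v > 0" "v dvd q - 1" "q \<ge> v ^ 3 + 4 * v"
    and a: "a \<in> K - {0}" "b \<in> K - {0}" "c \<in> K - {0}" "d \<in> K - {0}"
  shows "\<exists>k l m n. a * \<omega> ^ (v * k) + b * \<omega> ^ (v * l) + c * \<omega> ^ (v * m) + d * \<omega> ^ (v * n) = 0"
proof -
  define H where "H = range (\<lambda>k. \<omega> ^ (v * k))"
  obtain n where n: "n * v = q - 1" using v(2) by (metis dvd_def mult.commute)
  have npos: "n > 0" using n q_gt_1 by (cases n) auto
  \<comment> \<open>Only \<open>k\<close> modulo \<open>n\<close> matters, so \<open>n\<close>
    exponents suffice.\<close>
  have "H = (\<lambda>k. \<omega> ^ (v * k)) ` {..<n}"
  proof (intro subset_antisym subsetI)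
    fix x assume "x \<in> H"
    then obtain k where k: "x = \<omega> ^ (v * k)" by (auto simp: H_def)
    have "(v * k) mod (q - 1) = v * (k mod n)"
      unfolding n[symmetric] mult.commute[of n] by simp
    then have "\<omega> ^ (v * k) = \<omega> ^ (v * (k mod n))"
      unfolding \<omega>_power_eq_iff by (metis mod_mod_trivial)
    then show "x \<in> (\<lambda>k. \<omega> ^ (v * k)) ` {..<n}" using k npos by auto
  qed (auto simp: H_def)
  moreover have "inj_on (\<lambda>k. \<omega> ^ (v * k)) {..<n}"
  proof (rule inj_onI)
    fix k l assume kl: "k \<in> {..<n}" "l \<in> {..<n}" "\<omega> ^ (v * k) = \<omega> ^ (v * l)"
    then have "v * k < v * n" "v * l < v * n" using v(1) by simp_all
    then have "v * k < q - 1" "v * l < q - 1" using n by (simp_all only: mult.commute)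
    then show "k = l" using kl(3) v(1) by (simp add: \<omega>_power_eq_iff)
  qed
  ultimately have cardH: "card H = n" by (simp add: card_image)
  have HK: "H \<subseteq> K - {0}" by (auto simp: H_def \<omega>_in_K \<omega>_nonzero)
  have HH: "g * h \<in> H" if "g \<in> H" "h \<in> H" for g h
    using that by (auto simp: H_def simp flip: power_add distrib_left)
  define coset where "coset = (\<lambda>x. (\<lambda>h. x * h) ` H)"
  have coset: "coset x \<subseteq> K" "card (coset x) = card H" if "x \<in> K - {0}" for x
    using that HK by (auto simp: coset_def K_mult card_image inj_on_def)
  have inv: "h * y \<in> coset x" if "h \<in> H" "y \<in> coset x" for h x y
  proof -
    obtain g where "g \<in> H" "y = x * g" using \<open>y \<in> coset x\<close> by (auto simp: coset_def)
    then show ?thesis using HH[OF that(1)] by (auto simp: coset_def mult.left_commute)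
  qed
  \<comment> \<open>Two terms change sides, so that a zero sum becomes a common value of two
    sumsets.\<close>
  have neg: "- c \<in> K - {0}" "- d \<in> K - {0}" using a by (auto simp: K_uminus)
  have "\<exists>x\<in>coset a. \<exists>y\<in>coset b. \<exists>z\<in>coset (- c). \<exists>w\<in>coset (- d). x + y = z + w"
    by (rule cosets_sumsets_meet[of K _ _ _ _ H])
      (use K_0 K_add K_mult coset a neg HK inv cubic_size[OF v(1) n v(3)] cardH card_K in auto)
  then obtain k l m r where "a * \<omega> ^ (v * k) + b * \<omega> ^ (v * l) = - c * \<omega> ^ (v * m) + - d * \<omega> ^ (v * r)"
    unfolding coset_def H_def by blast
  then have "a * \<omega> ^ (v * k) + b * \<omega> ^ (v * l) + c * \<omega> ^ (v * m) + d * \<omega> ^ (v * r) = 0"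
    by (simp add: add.assoc)
  then show ?thesis by blast
qed

section \<open>From prescribed trace classes to rows of the array\<close>

text \<open>The exponents \<open>e\<close> are free because logarithms count only modulo
  \<open>v\<close>. For dependent points they are chosen so that the values satisfy the relation;
  three traces are then prescribed and the relation forces the fourth.\<close>

lemma traces_in_cosets:
  assumes v: "v > 0" "v dvd q - 1" "q \<ge> v ^ 3 + 4 * v"
    and S: "S \<subseteq> {..q ^ 2}" "card S = 4"
  shows "\<exists>x e. \<forall>c\<in>S. Tr (x * point c) = \<omega> ^ (g c + v * e c)"
proof (cases "independent S point")
  case True
  have "finite S" using S(1) finite_subset by blast
  from Tr_surjective[OF this True, of "\<lambda>c. \<omega> ^ (g c)"]
  obtain x where "\<forall>c\<in>S. Tr (x * point c) = \<omega> ^ (g c)" using \<omega>_in_K by blast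
  then show ?thesis by (intro exI[of _ x] exI[of _ "\<lambda>_. 0"]) simp
next
  case False
  have finS: "finite S" using S(1) finite_subset by blast
  from False obtain d i where d: "\<forall>c\<in>S. d c \<in> K" "(\<Sum>c\<in>S. d c * point c) = 0" "i \<in> S" "d i \<noteq> 0"
    unfolding independent_def by blast
  have drop: "independent (S - {c}) point" if "c \<in> S" for c
    using S that finS by (intro points_independent) auto
  \<comment> \<open>A zero coefficient would leave a nontrivial relation between the other three
    points.\<close>
  have nz: "d c \<noteq> 0" if c: "c \<in> S" for c
  proof
    assume "d c = 0"
    then have "(\<Sum>c\<in>S - {c}. d c * point c) = 0"
      using d(2) sum.remove[OF finS c, of "\<lambda>c. d c * point c"] by simp
    then have "\<forall>c\<in>S - {c}. d c = 0" using drop[OF c] d(1) unfolding independent_def by blast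
    then show False using d(3,4) \<open>d c = 0\<close> by blast
  qed
  have "card (S - {i}) = 3" using S(2) d(3) finS by simp
  then obtain j k l where jkl: "S - {i} = {j, k, l}" "j \<noteq> k" "j \<noteq> l" "k \<noteq> l"
    by (auto simp: card_3_iff)
  then have Seq: "S = {i, j, k, l}" "i \<noteq> j" "i \<noteq> k" "i \<noteq> l" using d(3) by auto
  \<comment> \<open>\<open>s\<close> merges the coefficients of the relation with representatives of
    the target classes.\<close>
  define s where "s = (\<lambda>c. d c * \<omega> ^ g c)"
  have s: "s c \<in> K - {0}" if "c \<in> S" for c
    using that d(1) nz \<omega>_nonzero by (simp add: s_def K_mult \<omega>_in_K)
  obtain ei ej ek el where
    "s i * \<omega> ^ (v * ei) + s j * \<omega> ^ (v * ej) + s k * \<omega> ^ (v * ek) + s l * \<omega> ^ (v * el) = 0"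
    using diagonal_equation_solvable[OF v s s s s, of i j k l] Seq by auto
  moreover define e where "e = (\<lambda>c. if c = i then ei else if c = j then ej else if c = k then ek else el)"
  moreover define t where "t = (\<lambda>c. \<omega> ^ (g c + v * e c))"
  ultimately have "(\<Sum>c\<in>S. d c * t c) = 0"
    using Seq jkl by (simp add: s_def power_add mult.assoc add.assoc)
  moreover have "finite (S - {i})" "\<forall>c\<in>S - {i}. t c \<in> K"
    using finS by (simp_all add: t_def \<omega>_in_K)
  then obtain x where x: "\<forall>c\<in>S - {i}. Tr (x * point c) = t c"
    using Tr_surjective[OF _ drop[OF d(3)]] by blast
  moreover have "(\<Sum>c\<in>S. d c * Tr (x * point c)) = 0"
  proof -
    have "(\<Sum>c\<in>S. d c * Tr (x * point c)) = (\<Sum>c\<in>S. Tr (d c * (x * point c)))"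
      using d(1) by (simp add: Tr_scale)
    also have "\<dots> = Tr (x * (\<Sum>c\<in>S. d c * point c))"
      by (simp only: Tr_sum sum_distrib_left mult.left_commute)
    finally show ?thesis by (simp add: d(2) Tr_0)
  qed
  \<comment> \<open>The traces and the values \<open>t\<close> satisfy the same relation and agree
    away from \<open>i\<close>.\<close>
  ultimately have "d i * Tr (x * point i) = d i * t i"
    by (simp add: sum.remove[OF finS d(3)] eq_neg_iff_add_eq_0[symmetric])
  then have "\<forall>c\<in>S. Tr (x * point c) = t c" using x nz[OF d(3)] by auto
  then show ?thesis by (auto simp: t_def)
qed

lemma row_exists:
  assumes v: "v > 0" "v dvd q - 1" and "S \<noteq> {}"
    and x: "\<forall>c\<in>S. Tr (x * point c) = \<omega> ^ e c"
  shows "\<exists>i<v * M. \<forall>c\<in>S. Tr (\<alpha> ^ (i + c * (q + 1))) \<noteq> 0 \<and>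
    discrete_log q \<omega> (Tr (\<alpha> ^ (i + c * (q + 1)))) mod v = e c mod v"
proof -
  have "x \<noteq> 0" using x \<open>S \<noteq> {}\<close> Tr_0 \<omega>_nonzero by fastforce
  then obtain m where m: "x = \<alpha> ^ m" using \<alpha>_generates by blast
  \<comment> \<open>Rows run only below \<open>v * M\<close>. The factor split off is
    \<open>\<omega> ^ (v * k)\<close>; it lies in \<open>K\<close>, comes out of the trace and
    shifts the logarithm by a multiple of \<open>v\<close>.\<close>
  define i where "i = m mod (v * M)"
  define k where "k = m div (v * M)"
  have "m = v * M * k + i" by (simp add: i_def k_def)
  then have "m = M * (v * k) + i" by (simp add: mult_ac)
  then have xi: "x = \<omega> ^ (v * k) * \<alpha> ^ i" by (simp add: m \<omega>_def power_add power_mult)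
  have "Tr (\<alpha> ^ (i + c * (q + 1))) \<noteq> 0 \<and>
    discrete_log q \<omega> (Tr (\<alpha> ^ (i + c * (q + 1)))) mod v = e c mod v" if "c \<in> S" for c
  proof -
    define T where "T = Tr (\<alpha> ^ (i + c * (q + 1)))"
    have "x * point c = \<omega> ^ (v * k) * \<alpha> ^ (i + c * (q + 1))"
      by (simp add: xi point_def power_add mult_ac)
    then have *: "\<omega> ^ (v * k) * T = \<omega> ^ e c"
      using x that Tr_scale[OF \<omega>_in_K] unfolding T_def by metis
    then have "T \<noteq> 0" using \<omega>_nonzero by (metis mult_zero_right power_not_zero)
    moreover from this obtain l where l: "T = \<omega> ^ l"
      using Tr_in_K K_eq_powers by (metis DiffI T_def imageE singletonD)
    have "(v * k + l) mod (q - 1) = e c mod (q - 1)"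
      using * by (simp only: l flip: power_add \<omega>_power_eq_iff)
    then have "(v * k + l) mod v = e c mod v"
      using v(2) by (metis mod_mod_cancel)
    then have "discrete_log q \<omega> T mod v = e c mod v"
      by (simp add: l discrete_log_mod[OF v(2)])
    ultimately show ?thesis by (simp add: T_def)
  qed
  moreover have "i < v * M" using v(1) M_pos by (simp add: i_def)
  ultimately show ?thesis by blast
qed

end

section \<open>The covering property\<close>

text \<open>This matches column \<open>c\<close> of the array with \<open>point c\<close>.\<close>

lemma sorted_list_of_multiples:
  fixes m n :: nat
  assumes "m > 0"
  shows "sorted_list_of_set {j * m | j. j \<in> {0..n}} = map (\<lambda>j. j * m) [0..<Suc n]"
proof (rule sorted_distinct_set_unique)
  show "sorted (map (\<lambda>j. j * m) [0..<Suc n])"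
    by (auto simp: sorted_iff_nth_mono simp del: upt_Suc)
  show "distinct (map (\<lambda>j. j * m) [0..<Suc n])"
    using assms by (auto simp: distinct_map inj_on_def simp del: upt_Suc)
  show "set (sorted_list_of_set {j * m | j. j \<in> {0..n}}) = set (map (\<lambda>j. j * m) [0..<Suc n])"
    by (auto simp: less_Suc_eq_le simp del: upt_Suc)
qed auto

theorem mainTheorem3:
  fixes q v :: nat and \<alpha> :: "'a :: {field, finite}" and C :: "nat set"
  assumes "primepow q"
    and "card (UNIV :: 'a set) = q ^ 4"
    and "primitive_element \<alpha>"
    and "C = {j * (q + 1) | j. j \<in> {0..q ^ 2}}"
    and "v > 0" and "v dvd q - 1"
    and "q \<ge> v ^ 3 + 4 * v"
  shows "covering_array {0..<v} (v * (q ^ 3 + q ^ 2 + q + 1)) 4 (q ^ 2 + 1) v (trace_array q \<alpha> C v)"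
proof -
  interpret quartic_extension q \<alpha> by unfold_locales fact+
  have C: "sorted_list_of_set C = map (\<lambda>j. j * (q + 1)) [0..<Suc (q ^ 2)]"
    unfolding assms(4) by (rule sorted_list_of_multiples) simp
  have "card C = length (sorted_list_of_set C)" by simp
  then have cardC: "card C = q ^ 2 + 1" by (simp add: C del: length_sorted_list_of_set)
  have nth: "sorted_list_of_set C ! c = c * (q + 1)" if "c < q ^ 2 + 1" for c
    using that by (simp add: C del: upt_Suc)
  define A where "A = trace_array q \<alpha> C v"
  have A: "A \<in> carrier_mat (v * M) (q ^ 2 + 1)"
    by (simp add: A_def trace_array_def Let_def cardC M_def)
  have entry: "A $$ (i, c) = (let x = Tr (\<alpha> ^ (i + c * (q + 1))) in
      if x \<noteq> 0 then discrete_log q \<omega> x mod v else 0)"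
    if "i < v * M" "c < q ^ 2 + 1" for i c
    using that by (simp add: A_def trace_array_def Let_def cardC nth M_def \<omega>_def)
  have "q \<ge> 2" using q_gt_1 by simp
  then have "4 \<le> q ^ 2 + 1" using power_mono[of 2 q 2] by simp
  moreover have "elements_mat A \<subseteq> {0..<v}"
  proof
    fix a assume "a \<in> elements_mat A"
    then obtain i c where "i < v * M" "c < q ^ 2 + 1" "a = A $$ (i, c)"
      using A by (auto dest!: elements_matD)
    then show "a \<in> {0..<v}" using \<open>v > 0\<close> by (simp add: entry Let_def)
  qed
  moreover have "\<exists>i<v * M. map (\<lambda>c. A $$ (i, c)) cs = xs"
    if "length cs = 4 \<and> distinct cs \<and> set cs \<subseteq> {..<q ^ 2 + 1} \<and> length xs = 4 \<and> set xs \<subseteq> {0..<v}" for cs xs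
  proof -
    \<comment> \<open>As the columns in \<open>cs\<close> are distinct, \<open>xs\<close> can be
      read as a function of the column.\<close>
    define g where "g = (\<lambda>c. the (map_of (zip cs xs) c))"
    have g: "map g cs = xs"
    proof (rule nth_equalityI)
      fix m assume "m < length (map g cs)"
      then show "map g cs ! m = xs ! m"
        using that by (simp add: g_def map_of_zip_nth)
    qed (use that in simp)
    have S: "set cs \<subseteq> {..q ^ 2}" "card (set cs) = 4"
      using that by (auto simp: distinct_card)
    obtain x e where "\<forall>c\<in>set cs. Tr (x * point c) = \<omega> ^ (g c + v * e c)"
      using traces_in_cosets[OF assms(5-7) S] by blast
    from row_exists[OF assms(5,6) _ this] S(2)
    obtain i where i: "i < v * M" "\<forall>c\<in>set cs. Tr (\<alpha> ^ (i + c * (q + 1))) \<noteq> 0 \<and>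
      discrete_log q \<omega> (Tr (\<alpha> ^ (i + c * (q + 1)))) mod v = (g c + v * e c) mod v"
      by fastforce
    have "A $$ (i, c) = g c" if c: "c \<in> set cs" for c
    proof -
      have "g c \<in> set xs" using g c by auto
      \<comment> \<open>Below \<open>v\<close>, the residue of \<open>g c + v * e c\<close> is
        \<open>g c\<close> itself.\<close>
      then have "g c < v" using \<open>length cs = 4 \<and> _\<close> by auto
      moreover have "c < q ^ 2 + 1" using S(1) c by auto
      ultimately show ?thesis using i c by (simp add: entry Let_def)
    qed
    then have "map (\<lambda>c. A $$ (i, c)) cs = xs" using g by (metis map_cong)
    then show ?thesis using i(1) by blast
  qed
  ultimately show ?thesis
    using A unfolding covering_array_def A_def M_def by simp
qed

end
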